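(* Let $(X,\rho)$ be a separable metric space. Then $\dim(X)=\sup_{x\in X}\dim_{\mathrm{loc}}(x)$. Moreover, if $X$ is compact then the supremum is attained.
   Context: $|A|=\sup\{\rho(x,y): x,y\in A\}\in[0,\infty]$ is the diameter of $A\subset X$. For $0\le s<\infty$, $\delta>0$ and $A\subset X$, put $H^s_\delta(A)=\inf\{\sum_{U\in\mathcal U}|U|^s\}$, the infimum over all at most countable families $\mathcal U$ of subsets of $X$ with $|U|\le\delta$ for each $U\in\mathcal U$ and $A\subset\bigcup\mathcal U$ (with $\inf\emptyset=\infty$, $0^0=1$, and the empty set contributing $0$), and $H^s(A)=\sup_{\delta>0}H^s_\delta(A)$ ($s$-dimensional Hausdorff measure). The Hausdorff dimension of $A$ is $\dim(A)=\inf\{s\ge0: H^s(A)=0\}\in[0,\infty]$. The local Hausdorff dimension is $\dim_{\mathrm{loc}}:X\to[0,\infty]$, $\dim_{\mathrm{loc}}(x)=\inf\{\dim(U): U\text{ an open neighborhood of }x\}$. The supremum is taken in $[0,\infty]$. *)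

theory Defs
  imports "HOL-Analysis.Analysis"
begin

context Metric_space
begin

text \<open>The library's \<^const>\<open>diameter\<close> is real-valued and returns 0 on unbounded sets; here the
  diameter lives in the interval from 0 to infinity. The supremum over the empty set is 0.\<close>

definition ediam :: "'a set \<Rightarrow> ennreal" where
  "ediam A = (SUP x\<in>A. SUP y\<in>A. ennreal (d x y))"

text \<open>The contribution of a covering set \<open>U\<close>. The zeroth power is treated separately because
  \<open>0 powr 0 = 0\<close> in the library, whereas here a nonempty set contributes 1 if \<open>s = 0\<close>.\<close>

definition diam_pow :: "real \<Rightarrow> 'a set \<Rightarrow> ennreal" where
  "diam_pow s U =
     (if U = {} then 0
      else if s = 0 then 1
      else if ediam U = \<infinity> then \<infinity>
      else ennreal (enn2real (ediam U) powr s))"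

definition delta_covers :: "real \<Rightarrow> 'a set \<Rightarrow> 'a set set set" where
  "delta_covers \<delta> A =
     {\<U>. countable \<U> \<and> (\<forall>U\<in>\<U>. U \<subseteq> M \<and> ediam U \<le> ennreal \<delta>) \<and> A \<subseteq> \<Union>\<U>}"

definition hausdorff_premeasure :: "real \<Rightarrow> real \<Rightarrow> 'a set \<Rightarrow> ennreal" where
  "hausdorff_premeasure s \<delta> A = (INF \<U>\<in>delta_covers \<delta> A. \<Sum>\<^sub>\<infinity>U\<in>\<U>. diam_pow s U)"

definition hausdorff_measure :: "real \<Rightarrow> 'a set \<Rightarrow> ennreal" where
  "hausdorff_measure s A = (SUP \<delta>\<in>{0<..}. hausdorff_premeasure s \<delta> A)"

definition hausdorff_dim :: "'a set \<Rightarrow> ennreal" where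
  "hausdorff_dim A = (INF s\<in>{s. 0 \<le> s \<and> hausdorff_measure s A = 0}. ennreal s)"

definition local_hausdorff_dim :: "'a \<Rightarrow> ennreal" where
  "local_hausdorff_dim x = (INF U\<in>{U. openin mtopology U \<and> x \<in> U}. hausdorff_dim U)"

end

end

theory Submission
  imports Defs
begin

text \<open>Hausdorff dimension is monotone and countably stable, and a separable metric space is a
  Lindelof space; the theorem is the combination of these two facts.

  Since the whole space is an open neighborhood of each of its points, every local dimension is at
  most the global one. For the converse, let \<open>s\<close> exceed all local dimensions. Each point then has an
  open neighborhood of dimension less than \<open>s\<close>, countably many of these neighborhoods cover the
  space, and countable stability bounds the global dimension by \<open>s\<close>.

  If the space is compact and no point attained the global dimension \<open>D\<close>, every point would have an
  open neighborhood of dimension strictly less than \<open>D\<close>. Finitely many of these cover the space, and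
  the maximum of finitely many numbers below \<open>D\<close> is still below \<open>D\<close>, so stability would give a
  dimension below \<open>D\<close>. This is where finiteness is essential: over a countable cover the strict
  inequalities may be lost in the supremum.

  Countable stability (\<open>hausdorff_dim_Union_le\<close>) rests on two properties of the sets of vanishing
  \<open>s\<close>-dimensional measure: they remain null for every larger exponent
  (\<open>hausdorff_measure_eq_0_exponent\<close>), so that members with different dimensions can be compared
  at one exponent, and they are closed under countable unions (\<open>hausdorff_measure_eq_0_UN\<close>).\<close>

text \<open>Countable subadditivity for sums over possibly overlapping families: each element of a finite
  part of the union is charged to one index whose set contains it.\<close>

lemma infsum_UN_le_suminf:
  fixes f :: "'b \<Rightarrow> ennreal"
  shows "infsum f (\<Union>i. A i) \<le> (\<Sum>i::nat. infsum f (A i))"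
proof -
  have "sum f F \<le> (\<Sum>i. infsum f (A i))" if F: "finite F" "F \<subseteq> (\<Union>i. A i)" for F
  proof -
    obtain g where g: "\<And>x. x \<in> F \<Longrightarrow> x \<in> A (g x)"
      using F(2) by (metis UN_E subsetD)
    have le: "sum f {x. x \<in> F \<and> g x = i} \<le> infsum f (A i)" for i
      unfolding nonneg_infsum_complete[of "A i" f, OF zero_le]
      using F(1) g by (intro SUP_upper) auto
    have "sum f F = (\<Sum>i\<in>g ` F. sum f {x. x \<in> F \<and> g x = i})"
      by (rule sum.image_gen[OF F(1)])
    also have "\<dots> \<le> (\<Sum>i\<in>g ` F. infsum f (A i))"
      by (intro sum_mono le)
    also have "\<dots> \<le> (\<Sum>i. infsum f (A i))"
      using F(1) by (intro sum_le_suminf) auto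
    finally show ?thesis .
  qed
  then show ?thesis
    by (subst nonneg_infsum_complete) (auto intro: SUP_least)
qed

context Metric_space
begin

text \<open>Powers of a number in the unit interval decrease with the exponent. The convention that
  nonempty sets count 1 at exponent 0 is compatible with this, as all the other powers are at most 1.\<close>

lemma diam_pow_antimono_exponent:
  assumes "ediam U \<le> 1" "0 \<le> s" "s \<le> t"
  shows "diam_pow t U \<le> diam_pow s U"
proof -
  let ?r = "enn2real (ediam U)"
  have fin: "ediam U \<noteq> \<infinity>"
    using assms(1) by (auto simp: top_unique)
  have r: "0 \<le> ?r" "?r \<le> 1"
    using enn2real_mono[OF assms(1)] by auto
  have "?r powr t \<le> ?r powr s"
    \<comment> \<open>A set of diameter 0 is no exception, because \<open>0 powr t = 0\<close> even for \<open>t = 0\<close>.\<close>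
  proof (cases "?r = 0")
    case False
    with r assms(3) show ?thesis by (intro powr_mono') auto
  qed auto
  moreover have "?r powr t \<le> 1"
    using r assms powr_mono2[of t ?r 1] by simp
  ultimately show ?thesis
    using fin assms by (auto simp: diam_pow_def ennreal_le_1 intro: ennreal_leI)
qed

lemma delta_covers_mono:
  "\<delta> \<le> \<delta>' \<Longrightarrow> A \<subseteq> B \<Longrightarrow> delta_covers \<delta> B \<subseteq> delta_covers \<delta>' A"
  unfolding delta_covers_def by (auto intro: order_trans[OF _ ennreal_leI])

text \<open>Being null amounts to having covers of arbitrarily small mesh and arbitrarily small total
  weight; the arguments below manipulate such covers instead of infima and suprema.\<close>

lemma hausdorff_measure_eq_0_iff:
  "hausdorff_measure s A = 0 \<longleftrightarrow>
     (\<forall>\<delta>>0. \<forall>\<epsilon>>0. \<exists>\<U>\<in>delta_covers \<delta> A. infsum (diam_pow s) \<U> < \<epsilon>)"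
proof -
  have "hausdorff_measure s A = 0 \<longleftrightarrow> (\<forall>\<delta>>0. hausdorff_premeasure s \<delta> A = 0)"
    unfolding hausdorff_measure_def le_zero_eq[symmetric] unfolding SUP_le_iff by auto
  moreover have "x = 0 \<longleftrightarrow> (\<forall>\<epsilon>>0. x < \<epsilon>)" for x :: ennreal
    by (metis less_irrefl zero_less_iff_neq_zero)
  ultimately show ?thesis
    unfolding hausdorff_premeasure_def by (simp only: INF_less_iff)
qed

text \<open>Refining to mesh at most 1 makes the weights at the larger exponent the smaller ones.\<close>

lemma hausdorff_measure_eq_0_exponent:
  assumes "hausdorff_measure s A = 0" "0 \<le> s" "s \<le> t"
  shows "hausdorff_measure t A = 0"
  unfolding hausdorff_measure_eq_0_iff
proof (intro allI impI)
  fix \<delta> :: real and \<epsilon> :: ennreal assume "0 < \<delta>" "0 < \<epsilon>"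
  then obtain \<U> where \<U>: "\<U> \<in> delta_covers (min \<delta> 1) A" "infsum (diam_pow s) \<U> < \<epsilon>"
    using assms(1) unfolding hausdorff_measure_eq_0_iff by (meson min_less_iff_conj zero_less_one)
  have "ediam U \<le> 1" if "U \<in> \<U>" for U
    using \<U>(1) that delta_covers_mono[of "min \<delta> 1" 1 A A] by (auto simp: delta_covers_def)
  then have "infsum (diam_pow t) \<U> \<le> infsum (diam_pow s) \<U>"
    using assms(2,3)
    by (intro infsum_mono[OF nonneg_summable_on_complete nonneg_summable_on_complete]
        diam_pow_antimono_exponent) auto
  moreover have "\<U> \<in> delta_covers \<delta> A"
    using \<U>(1) delta_covers_mono[of "min \<delta> 1" \<delta> A A] by auto
  ultimately show "\<exists>\<U>\<in>delta_covers \<delta> A. infsum (diam_pow t) \<U> < \<epsilon>"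
    using \<U>(2) by (meson le_less_trans)
qed

lemma hausdorff_measure_eq_0_subset:
  assumes "hausdorff_measure s B = 0" "A \<subseteq> B"
  shows "hausdorff_measure s A = 0"
  using assms delta_covers_mono[of _ _ A B] unfolding hausdorff_measure_eq_0_iff by blast

text \<open>The usual \<open>\<epsilon> / 2\<^sup>n\<close> argument: cover the \<open>i\<close>-th set with total weight less than
  \<open>e / 2\<^sup>i\<^sup>+\<^sup>1\<close> and take all the covers together.\<close>

lemma hausdorff_measure_eq_0_UN:
  assumes "\<And>i::nat. hausdorff_measure s (A i) = 0"
  shows "hausdorff_measure s (\<Union>i. A i) = 0"
  unfolding hausdorff_measure_eq_0_iff
proof (intro allI impI)
  fix \<delta> :: real and \<epsilon> :: ennreal assume "0 < \<delta>" "0 < \<epsilon>"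
  \<comment> \<open>As \<open>\<epsilon>\<close> may be infinite, the geometric series is scaled by a real number below it.\<close>
  obtain q where "0 < ennreal (of_rat q)" "ennreal (of_rat q) < \<epsilon>"
    using ennreal_rat_dense[OF \<open>0 < \<epsilon>\<close>] by blast
  then obtain e where e: "0 < e" "ennreal e < \<epsilon>"
    by (intro that[of "of_rat q"]) (simp_all only: ennreal_less_zero_iff)
  have pos: "0 < ennreal (e * (1/2) ^ Suc i)" for i
    unfolding ennreal_less_zero_iff using e(1) by (intro mult_pos_pos zero_less_power) auto
  have "\<exists>\<U>\<in>delta_covers \<delta> (A i). infsum (diam_pow s) \<U> < ennreal (e * (1/2) ^ Suc i)" for i
    using assms[of i, unfolded hausdorff_measure_eq_0_iff] \<open>0 < \<delta>\<close> pos by blast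
  then have "\<exists>\<U>. \<forall>i. \<U> i \<in> delta_covers \<delta> (A i)
      \<and> infsum (diam_pow s) (\<U> i) < ennreal (e * (1/2) ^ Suc i)"
    by (intro choice) blast
  then obtain \<U> where \<U>: "\<And>i. \<U> i \<in> delta_covers \<delta> (A i)"
    "\<And>i. infsum (diam_pow s) (\<U> i) < ennreal (e * (1/2) ^ Suc i)"
    by blast
  have "infsum (diam_pow s) (\<Union>i. \<U> i) \<le> (\<Sum>i. infsum (diam_pow s) (\<U> i))"
    by (rule infsum_UN_le_suminf)
  also have "\<dots> \<le> (\<Sum>i. ennreal (e * (1/2) ^ Suc i))"
    using \<U>(2) by (intro suminf_le less_imp_le) auto
  also have "\<dots> = ennreal (e * 1)"
    using e(1) by (intro suminf_ennreal_eq sums_mult power_half_series) auto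
  finally have "infsum (diam_pow s) (\<Union>i. \<U> i) < \<epsilon>"
    using e(2) by simp
  moreover have "(\<Union>i. \<U> i) \<in> delta_covers \<delta> (\<Union>i. A i)"
  proof -
    have cov: "countable (\<U> i)" "\<forall>U\<in>\<U> i. U \<subseteq> M \<and> ediam U \<le> ennreal \<delta>" "A i \<subseteq> \<Union>(\<U> i)" for i
      using \<U>(1)[of i] unfolding delta_covers_def by simp_all
    have "countable (\<Union>i. \<U> i)"
      by (intro countable_UN cov(1) countableI_type)
    moreover have "\<forall>U\<in>(\<Union>i. \<U> i). U \<subseteq> M \<and> ediam U \<le> ennreal \<delta>"
      unfolding ball_UN by (intro ballI cov(2)[THEN bspec])
    moreover have "(\<Union>i. A i) \<subseteq> \<Union>(\<Union>i. \<U> i)"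
      by (rule UN_least) (rule subset_trans[OF cov(3)], intro Union_mono UN_upper UNIV_I)
    ultimately show ?thesis
      unfolding delta_covers_def mem_Collect_eq by (intro conjI)
  qed
  ultimately show "\<exists>\<U>\<in>delta_covers \<delta> (\<Union>i. A i). infsum (diam_pow s) \<U> < \<epsilon>"
    by blast
qed

lemma hausdorff_measure_eq_0_Union:
  assumes "\<And>C. C \<in> \<C> \<Longrightarrow> hausdorff_measure s C = 0" "countable \<C>"
  shows "hausdorff_measure s (\<Union>\<C>) = 0"
proof (cases "\<C> = {}")
  case True
  have "{} \<in> delta_covers \<delta> {}" for \<delta>
    by (simp add: delta_covers_def)
  then show ?thesis
    unfolding hausdorff_measure_eq_0_iff True by (auto intro!: bexI[of _ "{}"])
next
  case False
  then have "\<Union>\<C> = (\<Union>i. from_nat_into \<C> i)"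
    using assms(2) by (simp add: range_from_nat_into)
  then show ?thesis
    using assms(1) False by (simp add: hausdorff_measure_eq_0_UN from_nat_into)
qed

lemma hausdorff_dim_mono: "A \<subseteq> B \<Longrightarrow> hausdorff_dim A \<le> hausdorff_dim B"
  unfolding hausdorff_dim_def
  by (intro INF_superset_mono) (auto intro: hausdorff_measure_eq_0_subset)

lemma hausdorff_measure_eq_0_if_dim_less:
  assumes "hausdorff_dim A < ennreal s"
  shows "hausdorff_measure s A = 0"
proof -
  obtain t where "0 \<le> t" "hausdorff_measure t A = 0" "ennreal t < ennreal s"
    using assms unfolding hausdorff_dim_def INF_less_iff by auto
  then show ?thesis
    by (auto intro: hausdorff_measure_eq_0_exponent simp: ennreal_less_iff)
qed

text \<open>Countable stability. At an exponent strictly above all the dimensions every member is null,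
  hence so is the union; the bound itself follows by letting the exponent decrease to it.\<close>

lemma hausdorff_dim_Union_le:
  assumes "countable \<C>" "\<And>C. C \<in> \<C> \<Longrightarrow> hausdorff_dim C \<le> D"
  shows "hausdorff_dim (\<Union>\<C>) \<le> D"
proof (rule dense_ge)
  fix x assume "D < x"
  show "hausdorff_dim (\<Union>\<C>) \<le> x"
  proof (cases x)
    case (real s)
    have "hausdorff_measure s C = 0" if "C \<in> \<C>" for C
      using assms(2)[OF that] \<open>D < x\<close> real by (auto intro!: hausdorff_measure_eq_0_if_dim_less)
    then have "hausdorff_measure s (\<Union>\<C>) = 0"
      using assms(1) by (rule hausdorff_measure_eq_0_Union)
    then show ?thesis
      unfolding hausdorff_dim_def real(2) using real(1) by (intro INF_lower) simp
  qed simp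
qed

text \<open>The balls of rational radius around the points of a countable dense set form a base: if the
  ball of radius \<open>r\<close> around \<open>x\<close> lies in the open set, choose a rational radius \<open>q < r / 2\<close> and a
  center within \<open>q\<close> of \<open>x\<close>.\<close>

lemma separable_imp_second_countable_mtopology:
  assumes "separable_space mtopology"
  shows "second_countable mtopology"
proof -
  obtain C where C: "countable C" "mtopology closure_of C = M"
    using assms by (auto simp: separable_space_def)
  let ?B = "(\<lambda>(c, q). mball c (of_rat q)) ` (C \<times> UNIV)"
  have "\<exists>V\<in>?B. x \<in> V \<and> V \<subseteq> U" if U: "openin mtopology U" "x \<in> U" for U x
  proof -
    obtain r where r: "0 < r" "mball x r \<subseteq> U" and x: "x \<in> M"
      using U unfolding openin_mtopology by blast
    obtain q where q: "0 < real_of_rat q" "of_rat q < r / 2"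
      using of_rat_dense[of 0 "r / 2"] r(1) by auto
    obtain c where c: "c \<in> C" "c \<in> mball x (of_rat q)"
      using C(2) x q(1) unfolding metric_closure_of by blast
    have "mball c (of_rat q) \<subseteq> mball x r"
      using c(2) q(2) by (intro mball_subset) (auto simp: commute)
    moreover have "x \<in> mball c (of_rat q)"
      using c(2) by (auto simp: commute)
    ultimately show ?thesis
      using c(1) r(2) by blast
  qed
  moreover have "countable ?B"
    using C(1) by auto
  ultimately show ?thesis
    unfolding second_countable_def by (intro exI[of _ ?B]) auto
qed

lemma local_hausdorff_dim_le_dim:
  "x \<in> M \<Longrightarrow> local_hausdorff_dim x \<le> hausdorff_dim M"
  unfolding local_hausdorff_dim_def by (rule INF_lower) (use openin_topspace[of mtopology] in simp)

text \<open>The open sets of dimension below \<open>s\<close> cover the space as soon as \<open>s\<close> exceeds all local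
  dimensions. The Lindelof property makes the cover countable, which stability requires.\<close>

lemma hausdorff_dim_eq_SUP_local:
  assumes "separable_space mtopology"
  shows "hausdorff_dim M = (SUP x\<in>M. local_hausdorff_dim x)" (is "_ = ?D")
proof (rule antisym)
  show "?D \<le> hausdorff_dim M"
    by (intro SUP_least local_hausdorff_dim_le_dim)
  show "hausdorff_dim M \<le> ?D"
  proof (rule dense_ge)
    fix s assume "?D < s"
    let ?\<U> = "{U. openin mtopology U \<and> hausdorff_dim U < s}"
    have "local_hausdorff_dim x < s" if "x \<in> M" for x
      using SUP_upper[of x M local_hausdorff_dim, OF that] \<open>?D < s\<close> by (rule le_less_trans)
    then have "\<exists>U\<in>?\<U>. x \<in> U" if "x \<in> M" for x
      using that unfolding local_hausdorff_dim_def INF_less_iff by blast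
    then have "\<Union>?\<U> = topspace mtopology"
      using openin_subset[of mtopology] unfolding topspace_mtopology by blast
    moreover have "Lindelof_space mtopology"
      using assms separable_imp_second_countable_mtopology second_countable_imp_Lindelof_space by blast
    ultimately obtain \<V> where \<V>: "countable \<V>" "\<V> \<subseteq> ?\<U>" "\<Union>\<V> = topspace mtopology"
      using Lindelof_spaceD[of mtopology ?\<U>] by (metis (no_types, lifting) mem_Collect_eq)
    have "hausdorff_dim (\<Union>\<V>) \<le> s"
      using \<V>(1,2) by (intro hausdorff_dim_Union_le) auto
    then show "hausdorff_dim M \<le> s"
      using \<V>(3) by simp
  qed
qed

text \<open>If no point attained it, the open sets of dimension strictly below that of the space would cover it, and a
  finite subcover would bound the dimension of the space by a maximum strictly below it.\<close>

lemma hausdorff_dim_attained_locally: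
  assumes "compact_space mtopology" "M \<noteq> {}"
  shows "\<exists>x\<in>M. local_hausdorff_dim x = hausdorff_dim M" (is "\<exists>x\<in>M. _ = ?D")
proof (rule ccontr)
  assume "\<not> ?thesis"
  then have less: "local_hausdorff_dim x < ?D" if "x \<in> M" for x
    using that local_hausdorff_dim_le_dim[OF that] by (auto simp: less_le)
  let ?\<U> = "{U. openin mtopology U \<and> hausdorff_dim U < ?D}"
  have "\<exists>U\<in>?\<U>. x \<in> U" if "x \<in> M" for x
    using less[OF that] unfolding local_hausdorff_dim_def INF_less_iff by blast
  then have "M \<subseteq> \<Union>?\<U>"
    by blast
  moreover have "compactin mtopology M"
    using assms(1) by (simp add: compact_space_def)
  ultimately obtain \<F> where \<F>: "finite \<F>" "\<F> \<subseteq> ?\<U>" "M \<subseteq> \<Union>\<F>"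
    using compactinD[of mtopology M ?\<U>] by auto
  have "\<F> \<noteq> {}"
    using \<F>(3) assms(2) by auto
  then have "(SUP U\<in>\<F>. hausdorff_dim U) < ?D"
    using \<F> by (subst finite_Sup_less_iff) auto
  moreover have "?D \<le> hausdorff_dim (\<Union>\<F>)"
    using \<F>(3) by (rule hausdorff_dim_mono)
  moreover have "hausdorff_dim (\<Union>\<F>) \<le> (SUP U\<in>\<F>. hausdorff_dim U)"
    using \<F>(1) by (intro hausdorff_dim_Union_le countable_finite SUP_upper)
  ultimately show False
    by simp
qed

end

theorem proposition2p7:
  fixes X :: "'a set" and \<rho> :: "'a \<Rightarrow> 'a \<Rightarrow> real"
  assumes "Metric_space X \<rho>"
    and "separable_space (Metric_space.mtopology X \<rho>)"
  shows "Metric_space.hausdorff_dim X \<rho> X = (SUP x\<in>X. Metric_space.local_hausdorff_dim X \<rho> x)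
    \<and> (compact_space (Metric_space.mtopology X \<rho>) \<and> X \<noteq> {} \<longrightarrow>
         (\<exists>x\<in>X. Metric_space.local_hausdorff_dim X \<rho> x
                 = (SUP y\<in>X. Metric_space.local_hausdorff_dim X \<rho> y)))"
proof -
  interpret Metric_space X \<rho>
    by (rule assms(1))
  show ?thesis
    using hausdorff_dim_eq_SUP_local[OF assms(2)] hausdorff_dim_attained_locally by auto
qed

end
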